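(* Let $k\geq 1$ be an integer, let $w \in \{1,2,\dots,k\}^{\mathbb{Z}}$ and let $S \subseteq \mathbb{Z}_{\geq 0}$ be nonempty. Then the $(S,w)$-gap shift $X_w(S)$ is mixing if and only if $$\gcd\{n+1 : n\in S\}=1.$$
   Context: A word over an alphabet is a finite sequence of letters; $|u|$ denotes the length of the word $u$, and $\epsilon$ is the empty word, with $|\epsilon|=0$. A nonempty word $u$ appears in a bi-infinite sequence $x=(x_i)_{i\in\mathbb{Z}}$ if $u=x_ix_{i+1}\cdots x_j$ for some integers $i\le j$; the empty word is regarded as appearing in every sequence. The $(S,w)$-gap shift is $$X_w(S)=\overline{\{\ldots 0\,u_{-1}\,0\,u_0\,0\,u_1\,0\ldots : u_i \text{ appears in } w,\ |u_i|\in S \text{ for all } i\in\mathbb{Z}\}}\subseteq\{0,1,\dots,k\}^{\mathbb{Z}},$$ i.e. the closure (in the product topology of the discrete topology) of the set of all bi-infinite concatenations, positioned arbitrarily, in which consecutive $0$'s are separated by words $u_i$ appearing in $w$ with $|u_i|\in S$ (the words $u_i$ may be chosen freely and independently). For a shift space $X$, $\mathcal{B}_n(X)$ is the set of words of length $n$ appearing in some point of $X$, and $\mathcal{B}(X)=\bigcup_{n\ge 0}\mathcal{B}_n(X)$. The shift $X$ is mixing if for all $u,u'\in\mathcal{B}(X)$ there is a positive integer $N$ such that for each $n\ge N$ there exists $v\in\mathcal{B}_n(X)$ with $uvu'\in\mathcal{B}(X)$. *)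

theory Defs
  imports "HOL-Analysis.Analysis"
begin

text \<open>Bi-infinite sequences are functions on \<^typ>\<open>int\<close>, words are lists, letters are natural numbers.
  Note that \<^term>\<open>[i..j]\<close> is the list of the integers from \<^term>\<open>i\<close> to \<^term>\<open>j\<close>, both included.\<close>

definition appears_in :: "'a list \<Rightarrow> (int \<Rightarrow> 'a) \<Rightarrow> bool" where
  "appears_in u x \<longleftrightarrow> u = [] \<or> (\<exists>i j. i \<le> j \<and> u = map x [i..j])"

text \<open>Here \<^term>\<open>p i\<close> is the position of the letter 0 preceding the word \<^term>\<open>u i\<close>. Comparing
  lengths gives \<open>p (i + 1) = p i + 1 + length (u i)\<close>, so the blocks \<open>0 # u i\<close> cover all of
  \<open>\<int>\<close> without overlap; the arbitrary value \<open>p 0\<close> provides the arbitrary positioning.\<close>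

definition gap_sequences :: "(int \<Rightarrow> nat) \<Rightarrow> nat set \<Rightarrow> (int \<Rightarrow> nat) set" where
  "gap_sequences w S = {x. \<exists>(u :: int \<Rightarrow> nat list) (p :: int \<Rightarrow> int).
     (\<forall>i. appears_in (u i) w \<and> length (u i) \<in> S) \<and>
     (\<forall>i. map x [p i..p (i + 1) - 1] = 0 # u i)}"

definition gap_shift :: "nat \<Rightarrow> (int \<Rightarrow> nat) \<Rightarrow> nat set \<Rightarrow> (int \<Rightarrow> nat) set" where
  "gap_shift k w S =
     product_topology (\<lambda>_. discrete_topology {0..k}) UNIV closure_of gap_sequences w S"

definition words_of_length :: "nat \<Rightarrow> (int \<Rightarrow> 'a) set \<Rightarrow> 'a list set" where
  "words_of_length n X = {u. length u = n \<and> (\<exists>x\<in>X. appears_in u x)}"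

definition language :: "(int \<Rightarrow> 'a) set \<Rightarrow> 'a list set" where
  "language X = (\<Union>n. words_of_length n X)"

definition mixing :: "(int \<Rightarrow> 'a) set \<Rightarrow> bool" where
  "mixing X \<longleftrightarrow> (\<forall>u\<in>language X. \<forall>u'\<in>language X. \<exists>N>0. \<forall>n\<ge>N.
     \<exists>v\<in>words_of_length n X. u @ v @ u' \<in> language X)"

end

theory Submission
  imports Defs
begin

text \<open>A word lies in the language of the closure iff it lies in the language of the gap sequences
  themselves, since cylinders are open. In a gap sequence the zeros are exactly the marks separating
  the blocks, so any two of them are congruent modulo the gcd \<open>d\<close> of the numbers \<open>n + 1\<close>; if the shift
  is mixing, then \<open>0 v 0\<close> occurs for all large lengths of \<open>v\<close>, which forces \<open>d = 1\<close>. Conversely, two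
  gap sequences can be cut at marks and glued. The possible distances between two marks form an
  additive monoid containing all \<open>n + 1\<close>, and if \<open>d = 1\<close> this monoid contains all large numbers.\<close>

section \<open>Numerical semigroups\<close>

lemma add_closed_mult:
  fixes T :: "nat set"
  assumes "0 \<in> T" "\<And>a b. a \<in> T \<Longrightarrow> b \<in> T \<Longrightarrow> a + b \<in> T" "a \<in> T"
  shows "q * a \<in> T"
  using assms by (induction q) auto

text \<open>The least positive difference \<open>d\<close> of two members of \<open>T\<close>
  divides every member of \<open>A\<close>, since a nonzero remainder mod \<open>d\<close> would be
  a smaller difference. So \<open>d = 1\<close>, and \<open>T\<close> contains two consecutive
  numbers \<open>b\<close> and \<open>b + 1\<close>, whose combinations reach all large
  numbers.\<close>

lemma numerical_semigroup_cofinite: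
  fixes T A :: "nat set"
  assumes zero: "0 \<in> T" and add: "\<And>a b. a \<in> T \<Longrightarrow> b \<in> T \<Longrightarrow> a + b \<in> T"
    and sub: "A \<subseteq> T" and gcd: "Gcd A = 1"
  obtains N where "\<And>n. n \<ge> N \<Longrightarrow> n \<in> T"
proof -
  note mult = add_closed_mult[OF zero add]
  define P where "P e \<longleftrightarrow> e > 0 \<and> (\<exists>b\<in>T. b + e \<in> T)" for e
  obtain m where m: "m \<in> A" "m \<noteq> 0"
    using gcd Gcd_0_iff[of A] by auto
  have "P m"
    unfolding P_def using m sub zero by (auto intro!: bexI[of _ 0])
  define d where "d = (LEAST e. P e)"
  have "P d"
    unfolding d_def using \<open>P m\<close> by (rule LeastI)
  then obtain b where d: "d > 0" and b: "b \<in> T" "b + d \<in> T"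
    by (auto simp: P_def)
  have "d dvd n" if "n \<in> A" for n
  proof (rule ccontr)
    assume "\<not> d dvd n"
    then have pos: "n mod d > 0"
      by (simp add: mod_greater_zero_iff_not_dvd)
    \<comment> \<open>Euclidean division of \<open>n\<close> by \<open>d\<close>, with
      \<open>(n div d) * b\<close> added on both sides: this exhibits \<open>n mod d\<close> as a
      difference of two members of \<open>T\<close>.\<close>
    have "(n div d) * (b + d) + n mod d = n + (n div d) * b"
      by (simp add: algebra_simps)
    moreover have "n + (n div d) * b \<in> T"
      using that sub b mult add by blast
    moreover have "(n div d) * (b + d) \<in> T"
      using b mult by blast
    ultimately have "P (n mod d)"
      unfolding P_def using pos by metis
    then have "d \<le> n mod d"
      unfolding d_def by (rule Least_le)
    with d show False
      by (meson mod_less_divisor not_le)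
  qed
  then have "d dvd Gcd A"
    by (rule Gcd_greatest)
  with gcd b have b1: "b + 1 \<in> T"
    by simp
  have "n \<in> T" if n: "n \<ge> b * b" for n
  proof (cases "b = 0")
    case True
    then show ?thesis
      using mult[of 1 n] b1 by simp
  next
    case False
    \<comment> \<open>From \<open>n = q * b + r\<close> with \<open>r \<le> q\<close>, turning
      \<open>r\<close> of the \<open>q\<close> summands \<open>b\<close> into \<open>b + 1\<close>
      absorbs the remainder. The bound \<open>b * b\<close> ensures \<open>b \<le> q\<close>, hence
      \<open>r \<le> q\<close>.\<close>
    define q r where "q = n div b" and "r = n mod b"
    have "b \<le> q"
      unfolding q_def using n False by (simp add: less_eq_div_iff_mult_less_eq)
    moreover have "r < b"
      unfolding r_def using False by simp
    ultimately have "r \<le> q"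
      by simp
    then obtain s where "q = r + s"
      using le_Suc_ex by blast
    then have "n = s * b + r * (b + 1)"
      using div_mult_mod_eq[of n b] unfolding q_def[symmetric] r_def[symmetric]
      by (simp add: algebra_simps)
    then show ?thesis
      using add mult b b1 by metis
  qed
  then show ?thesis
    by (rule that)
qed

section \<open>Words and gap sequences described by positions\<close>

lemma appears_in_iff_nth:
  "appears_in u x \<longleftrightarrow> (\<exists>a. \<forall>i<length u. u ! i = x (a + int i))"
proof
  assume "appears_in u x"
  then show "\<exists>a. \<forall>i<length u. u ! i = x (a + int i)"
    unfolding appears_in_def
  proof
    assume "\<exists>i j. i \<le> j \<and> u = map x [i..j]"
    then obtain i j where "u = map x [i..j]"
      by blast
    then have "\<forall>l<length u. u ! l = x (i + int l)"
      by auto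
    then show ?thesis
      by blast
  qed simp
next
  assume "\<exists>a. \<forall>i<length u. u ! i = x (a + int i)"
  then obtain a where a: "\<And>i. i < length u \<Longrightarrow> u ! i = x (a + int i)"
    by blast
  show "appears_in u x"
  proof (cases "u = []")
    case False
    then have "a \<le> a + int (length u) - 1"
      by (simp add: Suc_le_eq)
    moreover have "u = map x [a..a + int (length u) - 1]"
      by (rule nth_equalityI) (auto simp: a)
    ultimately show ?thesis
      unfolding appears_in_def by blast
  qed (simp add: appears_in_def)
qed

lemma mem_language_iff: "u \<in> language X \<longleftrightarrow> (\<exists>x\<in>X. appears_in u x)"
  by (auto simp: language_def words_of_length_def)

text \<open>A form of gap sequences without lists: \<open>p\<close> enumerates the marks, and the
  word after each mark is read off from \<open>x\<close>. It appears in \<open>w\<close> because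
  \<open>x\<close> agrees there with a translate of \<open>w\<close>; the shift \<open>c\<close> may
  change from block to block.\<close>

definition gap_decomp :: "(int \<Rightarrow> nat) \<Rightarrow> nat set \<Rightarrow> (int \<Rightarrow> nat) \<Rightarrow> (int \<Rightarrow> int) \<Rightarrow> bool" where
  "gap_decomp w S x p \<longleftrightarrow> (\<forall>i. p i < p (i + 1) \<and> nat (p (i + 1) - p i - 1) \<in> S \<and> x (p i) = 0 \<and>
     (\<exists>c. \<forall>m. p i < m \<longrightarrow> m < p (i + 1) \<longrightarrow> x m = w (m + c)))"

lemma gap_decompD:
  assumes "gap_decomp w S x p"
  shows "p i < p (i + 1)" "nat (p (i + 1) - p i - 1) \<in> S" "x (p i) = 0"
    "\<exists>c. \<forall>m. p i < m \<longrightarrow> m < p (i + 1) \<longrightarrow> x m = w (m + c)"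
  using assms unfolding gap_decomp_def by blast+

lemma gap_block_iff:
  "(\<exists>u. appears_in u w \<and> length u \<in> S \<and> map x [a..b - 1] = 0 # u) \<longleftrightarrow>
     a < b \<and> nat (b - a - 1) \<in> S \<and> x a = 0 \<and> (\<exists>c. \<forall>m. a < m \<longrightarrow> m < b \<longrightarrow> x m = w (m + c))"
  (is "?L \<longleftrightarrow> ?R")
proof
  assume ?L
  then obtain u where u: "appears_in u w" "length u \<in> S" "map x [a..b - 1] = 0 # u"
    by (elim exE conjE) (rule that)
  have ab: "a < b"
    using u(3) by (cases "a < b") auto
  then have xu: "x a = 0" "u = map x [a + 1..b - 1]"
    using u(3) by (simp_all add: upto_rec1)
  obtain s where s: "\<And>i. i < length u \<Longrightarrow> u ! i = w (s + int i)"
    using u(1) unfolding appears_in_iff_nth by blast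
  \<comment> \<open>Letter number \<open>i\<close> of \<open>u\<close> sits at position
    \<open>a + 1 + i\<close>, just past the leading 0, and equals \<open>w (s + i)\<close>.\<close>
  have "x m = w (m + (s - a - 1))" if "a < m" "m < b" for m
  proof -
    have "nat (m - a - 1) < length u"
      using xu that by simp
    from s[OF this] show ?thesis
      using xu that by (simp add: algebra_simps)
  qed
  then have "\<exists>c. \<forall>m. a < m \<longrightarrow> m < b \<longrightarrow> x m = w (m + c)"
    by blast
  then show ?R
    using ab xu u(2) by (simp add: algebra_simps)
next
  assume R: ?R
  then obtain c where c: "\<And>m. a < m \<Longrightarrow> m < b \<Longrightarrow> x m = w (m + c)"
    by blast
  let ?u = "map x [a + 1..b - 1]"
  have "\<forall>i<length ?u. ?u ! i = w (a + 1 + c + int i)"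
    using c by (auto simp: algebra_simps)
  then have "appears_in ?u w"
    unfolding appears_in_iff_nth by blast
  moreover have "length ?u \<in> S"
    using R by (simp add: algebra_simps)
  moreover have "map x [a..b - 1] = 0 # ?u"
    using R by (simp add: upto_rec1)
  ultimately show ?L
    by (intro exI[of _ ?u] conjI)
qed

lemma gap_sequences_iff: "x \<in> gap_sequences w S \<longleftrightarrow> (\<exists>p. gap_decomp w S x p)"
proof -
  have "x \<in> gap_sequences w S \<longleftrightarrow>
      (\<exists>p :: int \<Rightarrow> int. \<forall>i. \<exists>u. appears_in u w \<and> length u \<in> S \<and> map x [p i..p (i + 1) - 1] = 0 # u)"
    \<comment> \<open>For fixed \<open>p\<close> the conditions on the words are independent for
      different \<open>i\<close>, so the family \<open>u\<close> can be replaced by a separate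
      existential for each block, by choice.\<close>
    unfolding gap_sequences_def mem_Collect_eq conj_assoc all_conj_distrib[symmetric]
    by (subst ex_comm) (simp only: choice_iff conj_assoc)
  then show ?thesis
    unfolding gap_block_iff gap_decomp_def by simp
qed

lemma language_gap_sequencesE:
  assumes "u \<in> language (gap_sequences w S)"
  obtains x p a where "gap_decomp w S x p" "\<And>i. i < length u \<Longrightarrow> u ! i = x (a + int i)"
proof -
  obtain x where x: "x \<in> gap_sequences w S" "appears_in u x"
    using assms unfolding mem_language_iff by blast
  obtain p where "gap_decomp w S x p"
    using x(1) unfolding gap_sequences_iff by blast
  moreover obtain a where "\<forall>i<length u. u ! i = x (a + int i)"
    using x(2) unfolding appears_in_iff_nth by blast
  ultimately show ?thesis
    using that by blast
qed

section \<open>Marks of a gap sequence\<close>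

lemma int_partition_interval:
  fixes p :: "int \<Rightarrow> int"
  assumes "\<And>i. p i < p (i + 1)"
  obtains i where "p i \<le> m" "m < p (i + 1)"
proof -
  have up: "p i + int n \<le> p (i + int n)" for i n
  proof (induction n)
    case (Suc n)
    then show ?case
      using assms[of "i + int n"] by (simp add: algebra_simps)
  qed simp
  \<comment> \<open>Each index step moves \<open>p\<close> by at least 1, so going \<open>d\<close>
    indices to the left of 0 brings \<open>p\<close> down to \<open>m\<close> or below; if already
    \<open>p 0 \<le> m\<close>, then \<open>d = 0\<close>.\<close>
  define d where "d = nat (p 0 - m)"
  define i0 where "i0 = - int d"
  have "p 0 - m \<le> int d"
    by (simp add: d_def)
  then have i0: "p i0 \<le> m"
    using up[of i0 d] by (simp add: i0_def)
  \<comment> \<open>The first mark beyond \<open>m\<close>, counted from \<open>i0\<close>; it is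
    not \<open>i0\<close> itself, and its predecessor is the index sought.\<close>
  define n where "n = (LEAST n. m < p (i0 + int n))"
  have "m < p (i0 + int (nat (m - p i0) + 1))"
    using up[of i0 "nat (m - p i0) + 1"] i0 by simp
  then have n: "m < p (i0 + int n)"
    unfolding n_def by (rule LeastI)
  then obtain l where l: "n = Suc l"
    using i0 by (cases n) auto
  then have "\<not> m < p (i0 + int l)"
    using not_less_Least[of l "\<lambda>n. m < p (i0 + int n)"] unfolding n_def by simp
  then show ?thesis
    using that[of "i0 + int l"] n l by (simp add: algebra_simps)
qed

lemma gap_decomp_values:
  assumes "gap_decomp w S x p"
  shows "x m \<in> insert 0 (range w)"
proof -
  obtain i where i: "p i \<le> m" "m < p (i + 1)"
    using int_partition_interval[of p m] gap_decompD(1)[OF assms] by blast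
  then show ?thesis
    using gap_decompD(3,4)[OF assms, of i] by (cases "m = p i") auto
qed

text \<open>Strictly between two marks \<open>x\<close> copies letters of \<open>w\<close>, none of
  which is 0.\<close>

lemma gap_decomp_zero_marked:
  assumes "gap_decomp w S x p" "x m = 0" "0 \<notin> range w"
  obtains i where "m = p i"
proof -
  obtain i where i: "p i \<le> m" "m < p (i + 1)"
    using int_partition_interval[of p m] gap_decompD(1)[OF assms(1)] by blast
  have "m = p i"
  proof (rule ccontr)
    assume "m \<noteq> p i"
    then obtain c where "x m = w (m + c)"
      using gap_decompD(4)[OF assms(1), of i] i by force
    with assms(2,3) show False
      by (metis rangeI)
  qed
  then show ?thesis
    by (rule that)
qed

text \<open>Consecutive marks are at distance \<open>n + 1\<close> for some
  \<open>n \<in> S\<close>; the general case follows by telescoping.\<close>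

lemma gap_decomp_dvd_diff:
  assumes "gap_decomp w S x p" and d: "\<And>n. n \<in> S \<Longrightarrow> d dvd n + 1"
  shows "int d dvd p j - p i"
proof -
  have step: "int d dvd p (i + 1) - p i" for i
  proof -
    have "int d dvd int (nat (p (i + 1) - p i - 1) + 1)"
      unfolding int_dvd_int_iff using d gap_decompD(2)[OF assms(1)] by blast
    then show ?thesis
      using gap_decompD(1)[OF assms(1), of i] by simp
  qed
  have up: "int d dvd p (i + int n) - p i" for i n
  proof (induction n)
    case (Suc n)
    from dvd_add[OF this step[of "i + int n"]] show ?case
      by (simp add: algebra_simps)
  qed simp
  show ?thesis
  proof (cases "i \<le> j")
    case True
    then show ?thesis
      using up[of i "nat (j - i)"] by simp
  next
    case False
    then show ?thesis
      using up[of j "nat (i - j)"] by (simp add: dvd_diff_commute)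
  qed
qed

section \<open>Gluing, periodic gap sequences and bridges\<close>

text \<open>Cut \<open>x\<close> at its mark \<open>a\<close> and continue with \<open>y\<close>
  from its mark \<open>b\<close>, translated so that \<open>q b\<close> lands on \<open>p a\<close>.
  As marks increase, every block of the result lies wholly on one side of the cut and is inherited
  from \<open>x\<close> or from \<open>y\<close>.\<close>

lemma gap_decomp_glue:
  assumes x: "gap_decomp w S x p" and y: "gap_decomp w S y q"
  shows "gap_decomp w S (\<lambda>m. if m < p a then x m else y (m - p a + q b))
    (\<lambda>i. if i < a then p i else q (i - a + b) - q b + p a)" (is "gap_decomp w S ?z ?r")
proof -
  have mono_p: "p i \<le> p j" if "i \<le> j" for i j
    using that by (induction j rule: int_ge_induct)
      (auto intro: order_trans less_imp_le[OF gap_decompD(1)[OF x]])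
  have mono_q: "q i \<le> q j" if "i \<le> j" for i j
    using that by (induction j rule: int_ge_induct)
      (auto intro: order_trans less_imp_le[OF gap_decompD(1)[OF y]])
  have "?r i < ?r (i + 1) \<and> nat (?r (i + 1) - ?r i - 1) \<in> S \<and> ?z (?r i) = 0 \<and>
     (\<exists>c. \<forall>m. ?r i < m \<longrightarrow> m < ?r (i + 1) \<longrightarrow> ?z m = w (m + c))" for i
  proof (cases "i < a")
    case True
    \<comment> \<open>At the seam \<open>i + 1 = a\<close> the second branch applies, and its value
      is \<open>q b - q b + p a = p a\<close>.\<close>
    then have r: "?r i = p i" "?r (i + 1) = p (i + 1)"
      by (cases "i + 1 = a"; auto)+
    have le: "p (i + 1) \<le> p a"
      using mono_p True by simp
    have lt: "p i < p (i + 1)"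
      by (rule gap_decompD[OF x])
    obtain c where c: "\<And>m. p i < m \<Longrightarrow> m < p (i + 1) \<Longrightarrow> x m = w (m + c)"
      using gap_decompD(4)[OF x] by blast
    have "\<forall>m. p i < m \<longrightarrow> m < p (i + 1) \<longrightarrow> ?z m = w (m + c)"
      using c le by auto
    moreover have "?z (p i) = 0"
      using le lt gap_decompD(3)[OF x] by simp
    ultimately show ?thesis
      unfolding r using lt gap_decompD(2)[OF x] by blast
  next
    case False
    define j where "j = i - a + b"
    have r: "?r i = q j - q b + p a" "?r (i + 1) = q (j + 1) - q b + p a"
      using False by (auto simp: j_def algebra_simps)
    have le: "q b \<le> q j"
      using mono_q False by (simp add: j_def)
    have lt: "q j < q (j + 1)"
      by (rule gap_decompD[OF y])
    obtain c where c: "\<And>m. q j < m \<Longrightarrow> m < q (j + 1) \<Longrightarrow> y m = w (m + c)"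
      using gap_decompD(4)[OF y] by blast
    \<comment> \<open>Position \<open>m\<close> of the glued sequence is position
      \<open>m - p a + q b\<close> of \<open>y\<close>, which explains the corrected shift.\<close>
    have "\<forall>m. ?r i < m \<longrightarrow> m < ?r (i + 1) \<longrightarrow> ?z m = w (m + (c - p a + q b))"
      unfolding r using c le by (auto simp: algebra_simps)
    moreover have "?z (?r i) = 0"
      unfolding r using le gap_decompD(3)[OF y] by simp
    moreover have "nat (?r (i + 1) - ?r i - 1) \<in> S"
      unfolding r using gap_decompD(2)[OF y, of j] by simp
    moreover have "?r i < ?r (i + 1)"
      unfolding r using lt by simp
    ultimately show ?thesis
      by blast
  qed
  then show ?thesis
    unfolding gap_decomp_def by blast
qed

text \<open>The block 0 followed by the letters of \<open>w\<close> at positions 1 to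
  \<open>n\<close>, repeated forever. It shows that \<open>n + 1\<close> and its multiples occur as
  distances between marks, and that gap sequences exist.\<close>

lemma gap_decomp_periodic:
  assumes "n \<in> S"
  shows "gap_decomp w S (\<lambda>m. if int (n + 1) dvd m then 0 else w (m mod int (n + 1)))
    (\<lambda>i. i * int (n + 1))"
proof -
  let ?l = "int (n + 1)"
  have "m mod ?l = m - i * ?l \<and> \<not> ?l dvd m" if "i * ?l < m" "m < (i + 1) * ?l" for i m
  proof -
    have *: "m mod ?l = (m - i * ?l) mod ?l"
      by (simp add: mod_diff_eq[symmetric])
    also have "\<dots> = m - i * ?l"
      using that by (intro mod_pos_pos_trivial) (auto simp: algebra_simps)
    finally have "m mod ?l = m - i * ?l" .
    then show ?thesis
      using that by (auto simp: dvd_eq_mod_eq_0)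
  qed
  then have "\<exists>c. \<forall>m. i * ?l < m \<longrightarrow> m < (i + 1) * ?l \<longrightarrow>
      (if ?l dvd m then 0 else w (m mod ?l)) = w (m + c)" for i
    by (intro exI[of _ "- (i * ?l)"]) simp
  moreover have "nat ((i + 1) * ?l - i * ?l - 1) = n" for i
    by (simp add: algebra_simps)
  moreover have "i * ?l < (i + 1) * ?l" for i
    by simp
  ultimately show ?thesis
    unfolding gap_decomp_def using assms by (metis dvd_triv_right)
qed

text \<open>For every large \<open>t\<close>, the part of \<open>x\<close> before any mark and the
  part of \<open>y\<close> from any mark on can be joined across a stretch of exactly
  \<open>t\<close> positions. The bound \<open>N\<close> is uniform in \<open>x\<close>,
  \<open>y\<close> and the marks. The stretch is cut from a third gap sequence having two marks at
  distance \<open>t\<close>.\<close>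

lemma gap_decomp_bridge:
  assumes "Gcd {n + 1 | n. n \<in> S} = 1"
  obtains N where "\<And>t x p y q a b. t \<ge> N \<Longrightarrow> gap_decomp w S x p \<Longrightarrow> gap_decomp w S y q \<Longrightarrow>
    \<exists>z\<in>gap_sequences w S. (\<forall>m<p a. z m = x m) \<and> (\<forall>m\<ge>p a + int t. z m = y (m - p a - int t + q b))"
proof -
  \<comment> \<open>The possible distances from a mark to a later or equal mark, normalised so that
    the first one has index 0 and position 0. Periodic sequences put each \<open>n + 1\<close> into
    \<open>T\<close>, and gluing makes \<open>T\<close> closed under addition.\<close>
  define T where "T = {t. \<exists>z p j. gap_decomp w S z p \<and> p 0 = 0 \<and> p (int j) = int t}"
  obtain n0 where n0: "n0 \<in> S"
    using assms by fastforce
  have per: "i * (n + 1) \<in> T" if "n \<in> S" for i n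
    unfolding T_def mem_Collect_eq
    by (intro exI[of _ i] exI conjI, rule gap_decomp_periodic[OF that]) (simp_all add: algebra_simps)
  have zero: "0 \<in> T"
    using per[OF n0, of 0] by simp
  have add: "s + t \<in> T" if st: "s \<in> T" "t \<in> T" for s t
  proof -
    obtain x p i where x: "gap_decomp w S x p" "p 0 = 0" "p (int i) = int s"
      using st(1) unfolding T_def by blast
    obtain y q j where y: "gap_decomp w S y q" "q 0 = 0" "q (int j) = int t"
      using st(2) unfolding T_def by blast
    \<comment> \<open>The marks after gluing \<open>y\<close> from its mark 0 onto \<open>x\<close>
      at its mark \<open>i\<close>; the terms \<open>+ 0\<close> and \<open>q 0\<close> keep the
      shape of the gluing lemma.\<close>
    let ?r = "\<lambda>l. if l < int i then p l else q (l - int i + 0) - q 0 + p (int i)"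
    have "?r 0 = 0"
      using x y by (cases i) auto
    moreover have "?r (int (i + j)) = int (s + t)"
      using x y by simp
    ultimately show ?thesis
      unfolding T_def using gap_decomp_glue[OF x(1) y(1), of "int i" 0] by blast
  qed
  have "{n + 1 | n. n \<in> S} \<subseteq> T"
    using per[of _ 1] by auto
  from numerical_semigroup_cofinite[OF zero add this assms] obtain N where N: "\<And>t. t \<ge> N \<Longrightarrow> t \<in> T"
    by blast
  show ?thesis
  proof (rule that)
    fix t x p y q and a b :: int
    assume t: "t \<ge> N" and x: "gap_decomp w S x p" and y: "gap_decomp w S y q"
    obtain z r j where z: "gap_decomp w S z r" "r 0 = 0" "r (int j) = int t"
      using N[OF t] unfolding T_def by blast
    \<comment> \<open>First gluing: \<open>x\<close> up to its mark \<open>a\<close>, then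
      \<open>z\<close> from its mark 0. The mark \<open>a + j\<close> of the result lies at
      \<open>p a + t\<close>, and \<open>y\<close> is glued on there.\<close>
    define z' where "z' = (\<lambda>m. if m < p a then x m else z (m - p a + r 0))"
    define r' where "r' = (\<lambda>i. if i < a then p i else r (i - a + 0) - r 0 + p a)"
    have z': "gap_decomp w S z' r'"
      unfolding z'_def r'_def by (rule gap_decomp_glue[OF x z(1)])
    have r': "r' (a + int j) = p a + int t"
      unfolding r'_def using z by simp
    let ?z = "\<lambda>m. if m < r' (a + int j) then z' m else y (m - r' (a + int j) + q b)"
    have "?z \<in> gap_sequences w S"
      unfolding gap_sequences_iff using gap_decomp_glue[OF z' y] by blast
    moreover have "\<forall>m<p a. ?z m = x m"
      unfolding r' by (simp add: z'_def)
    moreover have "\<forall>m\<ge>p a + int t. ?z m = y (m - p a - int t + q b)"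
      unfolding r' by (simp add: algebra_simps)
    ultimately show "\<exists>z\<in>gap_sequences w S. (\<forall>m<p a. z m = x m) \<and>
        (\<forall>m\<ge>p a + int t. z m = y (m - p a - int t + q b))"
      by (intro bexI[of _ ?z] conjI)
  qed
qed

section \<open>Passing from the closure to the gap sequences\<close>

text \<open>A word constrains only finitely many coordinates, so the points agreeing with
  \<open>x\<close> on its window form an open neighbourhood of \<open>x\<close>, which meets
  \<open>G\<close> when \<open>x\<close> is in the closure.\<close>

lemma language_closure_of:
  assumes "G \<subseteq> UNIV \<rightarrow> A"
  shows "language (product_topology (\<lambda>_. discrete_topology A) UNIV closure_of G) = language G"
    (is "language (?T closure_of G) = _")
proof (intro set_eqI iffI)
  fix u
  assume "u \<in> language G"
  moreover have "G \<subseteq> ?T closure_of G"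
    using assms by (intro closure_of_subset) (auto simp: PiE_UNIV_domain)
  ultimately show "u \<in> language (?T closure_of G)"
    unfolding mem_language_iff by blast
next
  fix u
  assume "u \<in> language (?T closure_of G)"
  then obtain x a where x: "x \<in> ?T closure_of G" and a: "\<And>i. i < length u \<Longrightarrow> u ! i = x (a + int i)"
    unfolding mem_language_iff appears_in_iff_nth by blast
  let ?J = "(\<lambda>i. a + int i) ` {..<length u}"
  let ?U = "PiE UNIV (\<lambda>m. if m \<in> ?J then {x m} else A)"
  have xA: "x m \<in> A" for m
    using closure_of_subset_topspace[of ?T G] x by (auto simp: PiE_UNIV_domain)
  have "{m. (if m \<in> ?J then {x m} else A) \<noteq> A} \<subseteq> ?J"
    by auto
  then have "finite {m. (if m \<in> ?J then {x m} else A) \<noteq> A}"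
    by (rule finite_subset) simp
  then have "openin ?T ?U"
    unfolding openin_PiE_gen using xA by simp
  moreover have "x \<in> ?U"
    using xA by auto
  ultimately obtain y where y: "y \<in> G" "y \<in> ?U"
    using x unfolding in_closure_of by blast
  have "y m = x m" if "m \<in> ?J" for m
    using y(2) that by (auto simp: PiE_UNIV_domain dest!: Pi_mem[of _ _ _ m])
  then have "appears_in u y"
    unfolding appears_in_iff_nth using a by (intro exI[of _ a]) simp
  then show "u \<in> language G"
    using y(1) unfolding mem_language_iff by blast
qed

text \<open>The words of length \<open>n\<close> of a set are the members of its language of that
  length, so mixing depends on the language alone.\<close>

lemma mixing_cong_language:
  assumes "language X = language Y"
  shows "mixing X \<longleftrightarrow> mixing Y"
proof -
  have "words_of_length n X = {u \<in> language X. length u = n}" for n and X :: "(int \<Rightarrow> 'a) set"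
    unfolding language_def words_of_length_def by auto
  then show ?thesis
    unfolding mixing_def using assms by simp
qed

section \<open>The two implications\<close>

text \<open>Choose a mark of \<open>x\<close> to the right of \<open>u\<close> and a mark of
  \<open>y\<close> at or before the start of \<open>u'\<close>, and bridge them; the word between
  the two occurrences is \<open>v\<close>.\<close>

lemma mixing_gap_sequences_if_Gcd:
  assumes "Gcd {n + 1 | n. n \<in> S} = 1"
  shows "mixing (gap_sequences w S)"
  unfolding mixing_def
proof (intro ballI)
  let ?G = "gap_sequences w S"
  fix u u'
  assume u: "u \<in> language ?G" and u': "u' \<in> language ?G"
  obtain x p a where x: "gap_decomp w S x p"
    and a: "\<And>i. i < length u \<Longrightarrow> u ! i = x (a + int i)"
    using language_gap_sequencesE[OF u] by blast
  obtain y q a' where y: "gap_decomp w S y q"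
    and a': "\<And>i. i < length u' \<Longrightarrow> u' ! i = y (a' + int i)"
    using language_gap_sequencesE[OF u'] by blast
  obtain i where "a + int (length u) < p (i + 1)"
    using int_partition_interval[of p "a + int (length u)", OF gap_decompD(1)[OF x]] by blast
  then obtain i where i: "a + int (length u) < p i"
    by blast
  obtain j where j: "q j \<le> a'"
    using int_partition_interval[of q a', OF gap_decompD(1)[OF y]] by blast
  obtain N where N: "\<And>t x p y q a b. t \<ge> N \<Longrightarrow> gap_decomp w S x p \<Longrightarrow> gap_decomp w S y q \<Longrightarrow>
    \<exists>z\<in>?G. (\<forall>m<p a. z m = x m) \<and> (\<forall>m\<ge>p a + int t. z m = y (m - p a - int t + q b))"
    using gap_decomp_bridge[OF assms] by blast
  \<comment> \<open>The fixed part of the length of \<open>v\<close>: from the end of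
    \<open>u\<close> to the mark \<open>p i\<close>, and from the mark \<open>q j\<close> to the
    start of \<open>u'\<close>. The bridge has the remaining length
    \<open>t = n - l\<close>.\<close>
  define l where "l = nat (p i - (a + int (length u)) + (a' - q j))"
  have "\<exists>v\<in>words_of_length n ?G. u @ v @ u' \<in> language ?G" if n: "n \<ge> N + l + 1" for n
  proof -
    obtain t where t: "n = t + l" "t \<ge> N"
      using n by (intro that[of "n - l"]) auto
    obtain z where z: "z \<in> ?G" "\<And>m. m < p i \<Longrightarrow> z m = x m"
        "\<And>m. m \<ge> p i + int t \<Longrightarrow> z m = y (m - p i - int t + q j)"
      using N[OF t(2) x y] by blast
    define v where "v = map (\<lambda>m. z (a + int (length u) + int m)) [0..<n]"
    have "appears_in v z"
      unfolding appears_in_iff_nth v_def by (intro exI[of _ "a + int (length u)"]) simp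
    then have "v \<in> words_of_length n ?G"
      unfolding words_of_length_def using z(1) by (auto simp: v_def)
    moreover have "(u @ v @ u') ! m = z (a + int m)" if m: "m < length (u @ v @ u')" for m
    proof -
      consider "m < length u" | "length u \<le> m" "m < length u + n" | "length u + n \<le> m"
        by linarith
      then show ?thesis
      proof cases
        case 1
        then show ?thesis
          using a i z(2) by (simp add: nth_append)
      next
        case 2
        then obtain s where "m = length u + s" "s < n"
          by (metis le_Suc_ex nat_add_left_cancel_less)
        then show ?thesis
          by (simp add: nth_append v_def add.assoc)
      next
        case 3
        define s where "s = m - length u - n"
        have s: "m = length u + n + s" "s < length u'"
          using 3 m by (auto simp: s_def v_def)
        \<comment> \<open>Since \<open>q j \<le> a'\<close>, this position is at or beyond the end
          \<open>p i + t\<close> of the bridge, where \<open>z\<close> is the translate of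
          \<open>y\<close>.\<close>
        have "a + int m = p i + int t + (a' - q j) + int s"
          using s(1) t(1) i j by (simp add: l_def)
        then have "z (a + int m) = y (a' + int s)"
          using z(3)[of "a + int m"] j by simp
        then show ?thesis
          using s a' by (simp add: nth_append v_def)
      qed
    qed
    then have "u @ v @ u' \<in> language ?G"
      unfolding mem_language_iff appears_in_iff_nth using z(1) by blast
    ultimately show ?thesis
      by blast
  qed
  \<comment> \<open>The summand 1 makes the threshold positive.\<close>
  then show "\<exists>N>0. \<forall>n\<ge>N. \<exists>v\<in>words_of_length n ?G. u @ v @ u' \<in> language ?G"
    by (intro exI[of _ "N + l + 1"]) simp
qed

text \<open>Mixing is applied to the word \<open>[0]\<close> twice: the two zeros around a word
  \<open>v\<close> of length \<open>n\<close> are marks at distance \<open>n + 1\<close>, so the gcd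
  divides \<open>n + 1\<close> for all large \<open>n\<close>.\<close>

lemma Gcd_if_mixing_gap_sequences:
  assumes "S \<noteq> {}" "0 \<notin> range w" and mix: "mixing (gap_sequences w S)"
  shows "Gcd {n + 1 | n. n \<in> S} = 1"
proof -
  let ?d = "Gcd {n + 1 | n. n \<in> S}"
  obtain n0 where "n0 \<in> S"
    using assms(1) by blast
  note per = gap_decomp_periodic[OF this, of w]
  have "[0] \<in> language (gap_sequences w S)"
    unfolding mem_language_iff appears_in_iff_nth
  proof (intro bexI exI allI impI)
    show "(\<lambda>m. if int (n0 + 1) dvd m then 0 else w (m mod int (n0 + 1))) \<in> gap_sequences w S"
      unfolding gap_sequences_iff using per by blast
    show "[0] ! i = (if int (n0 + 1) dvd 0 + int i then 0 else w ((0 + int i) mod int (n0 + 1)))"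
      if "i < length [0 :: nat]" for i
      using that by simp
  qed
  then obtain N where N: "\<And>n. n \<ge> N \<Longrightarrow>
      \<exists>v\<in>words_of_length n (gap_sequences w S). [0] @ v @ [0] \<in> language (gap_sequences w S)"
    using mix unfolding mixing_def by blast
  have dvd: "?d dvd n + 1" if n: "n \<ge> N" for n
  proof -
    obtain v where v: "length v = n" "[0] @ v @ [0] \<in> language (gap_sequences w S)"
      using N[OF n] unfolding words_of_length_def by blast
    obtain x p a where x: "gap_decomp w S x p"
      and a: "\<And>i. i < length ([0] @ v @ [0]) \<Longrightarrow> ([0] @ v @ [0]) ! i = x (a + int i)"
      using language_gap_sequencesE[OF v(2)] by blast
    have "x a = 0" and zero: "x (a + int (n + 1)) = 0"
      using a[of 0] a[of "n + 1"] v by (auto simp: nth_append)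
    then obtain i where i: "a = p i"
      using gap_decomp_zero_marked[OF x _ assms(2)] by blast
    obtain j where j: "a + int (n + 1) = p j"
      using gap_decomp_zero_marked[OF x zero assms(2)] by blast
    have "int ?d dvd p j - p i"
      using x by (rule gap_decomp_dvd_diff) (auto intro: Gcd_dvd)
    then have "int ?d dvd int (n + 1)"
      unfolding i[symmetric] j[symmetric] by (simp only: add_diff_cancel_left')
    then show ?thesis
      unfolding int_dvd_int_iff .
  qed
  \<comment> \<open>The lengths \<open>N + 1\<close> and \<open>N\<close> give two consecutive
    multiples of the gcd, whose difference is 1.\<close>
  have "?d dvd (N + 1 + 1) - (N + 1)"
    by (intro dvd_diff_nat dvd) auto
  then show ?thesis
    by simp
qed

theorem proposition4p7:
  fixes k :: nat and w :: "int \<Rightarrow> nat" and S :: "nat set"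
  assumes "k \<ge> 1"
    and "\<forall>i. w i \<in> {1..k}"
    and "S \<noteq> {}"
  shows "mixing (gap_shift k w S) \<longleftrightarrow> Gcd {n + 1 | n. n \<in> S} = 1"
proof -
  \<comment> \<open>Gap sequences use only the letters 0 to \<open>k\<close>, so they are points of
    the product space and the closure lemma applies.\<close>
  have "x m \<in> {0..k}" if "x \<in> gap_sequences w S" for x m
  proof -
    have "x m \<in> insert 0 (range w)"
      using that gap_decomp_values unfolding gap_sequences_iff by blast
    then show ?thesis
      using assms(2) by auto
  qed
  then have "gap_sequences w S \<subseteq> UNIV \<rightarrow> {0..k}"
    by blast
  then have "language (gap_shift k w S) = language (gap_sequences w S)"
    unfolding gap_shift_def by (rule language_closure_of)
  then have "mixing (gap_shift k w S) \<longleftrightarrow> mixing (gap_sequences w S)"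
    by (rule mixing_cong_language)
  moreover have "0 \<notin> range w"
    using assms(2) by (metis atLeastAtMost_iff not_one_le_zero rangeE)
  ultimately show ?thesis
    using mixing_gap_sequences_if_Gcd Gcd_if_mixing_gap_sequences[OF assms(3)] by blast
qed

end
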